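(* Let $p=p(x,t;y)$, $x\in D$, $y\in\Omega$, be the exact solution and let $p_h=\{p_{ik}^n\}$ be its SFV-cluster approximation, with $\mathbb{E}[p]$, $\mathbb{V}[p]$ the exact mean and variance and $E_h[p_h]$, $V_h[p_h]$ their SFV-cluster approximations, computed with cell weights $\tilde\alpha_k$ obtained from $N$ samples and $N_y$ clusters (all as defined in the context). Assume that $$\|p-p_h\|_{L^\infty(D\times\Omega)}\leqslant C_1\Delta x^{q}+C_2\Delta y^{r},$$ and that the Monte Carlo weight error satisfies $|\alpha_k-\tilde\alpha_k|\lesssim \sigma_k/\sqrt N$ for every $k=1,\dots,N_y$. Put $\sigma=\max_{1\le k\le N_y}\sigma_k$. Then there are constants $C_3,C_1',C_2',C_3'$ such that $$\|\mathbb{E}[p]-E_h[p_h]\|_{L^\infty(D)}\leqslant C_1\Delta x^{q}+C_2\Delta y^{r}+C_3\frac{\sigma N_y}{\sqrt N},$$ $$\|\mathbb{V}[p]-V_h[p_h]\|_{L^\infty(D)}\leqslant C_1'\Delta x^{q}+C_2'\Delta y^{r}+C_3'\frac{\sigma N_y}{\sqrt N}.$$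
   Context: Setting. $D$ is the physical domain, partitioned into cells $\Delta x_i$ with centers $x_i$ and mesh size $\Delta x$. $\Omega$ is the parameter space, and the random parameter $y\in\Omega$ has probability density $\rho$, with associated probability measure $P$. The sets $\omega_1,\dots,\omega_{N_y}$ (clusters, regarded as cells) partition $\Omega$ up to null sets: $P(\omega_j\cap\omega_k)=0$ for $j\ne k$ and $\Omega=\bigcup_{k=1}^{N_y}\omega_k$. $\Delta y$ denotes the largest radius of the clusters. $N_y$ is the number of clusters. The exponents $q,r$ are the orders of the scheme in the physical and parameter variables. Approximation. At a time level $t=t^n$, $p_{ik}^n$ is the approximate value of $p$ in physical cell $i$ and parameter cell $\omega_k$; $p_h=\{p_{ik}^n\}$ is identified with the function on $D\times\Omega$ equal to $p_{ik}^n$ on $\Delta x_i\times\omega_k$. Exact mean and variance: $$\mathbb{E}[p](x_i,t^n)=\int_\Omega p(x_i,t^n;y)\rho(y)\,dy,\qquad \mathbb{V}[p](x_i,t^n)=\mathbb{E}[p^2](x_i,t^n)-\big(\mathbb{E}[p](x_i,t^n)\big)^2 .$$ Weights: let $y_1,\dots,y_N$ be $N$ Monte Carlo samples of $y$ and $$\alpha_k=\int_{\omega_k}\rho(y)\,dy,\qquad \tilde\alpha_k=\frac1N\sum_{j=1}^N \mathbf 1(y_j\in\omega_k).$$ $\sigma_k$ is the standard deviation of the random variable $\mathbf 1(y\in\omega_k)$. SFV-cluster mean and variance: $$E_h[p_h]_i^n=\sum_{k=1}^{N_y}p_{ik}^n\tilde\alpha_k,\qquad V_h[p_h]_i^n=E_h[p_h^2]_i^n-\big(E_h[p_h]_i^n\big)^2,\qquad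 E_h[p_h^2]_i^n=\sum_{k=1}^{N_y}(p_{ik}^n)^2\tilde\alpha_k .$$ Norms over $D$ compare these quantities in physical space (values at $x_i$, i.e. on cell $i$) at a time level $t^n$. The notation $a\lesssim b$ means $a\le c\,b$ with a constant $c$ independent of $\Delta x,\Delta y,N,N_y$. The constants $C_1,C_2,C_3,C_1',C_2',C_3'$ are independent of $\Delta x,\Delta y,N,N_y$ except that they may depend on the $L^\infty(D\times\Omega)$ norms of $p$ and $p_h$. *)

theory Defs
  imports "HOL-Probability.Probability"
begin

text \<open>Essential supremum of the modulus. It is \<open>\<infinity>\<close> for unbounded functions (and when the modulus
  is not measurable), and \<open>-\<infinity>\<close> when the whole space is null.\<close>

definition Linf_norm :: "'z measure \<Rightarrow> ('z \<Rightarrow> real) \<Rightarrow> ereal" where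
  "Linf_norm M f = esssup M (\<lambda>z. ereal \<bar>f z\<bar>)"

definition param_measure :: "'b::euclidean_space set \<Rightarrow> ('b \<Rightarrow> real) \<Rightarrow> 'b measure" where
  "param_measure \<Omega> \<rho> = density (restrict_space lborel \<Omega>) (\<lambda>y. ennreal (\<rho> y))"

definition prob_density_on :: "'b::euclidean_space set \<Rightarrow> ('b \<Rightarrow> real) \<Rightarrow> bool" where
  "prob_density_on \<Omega> \<rho> \<longleftrightarrow>
     \<Omega> \<in> sets lborel \<and> \<rho> \<in> borel_measurable (restrict_space lborel \<Omega>) \<and>
     (\<forall>y\<in>\<Omega>. 0 \<le> \<rho> y) \<and> prob_space (param_measure \<Omega> \<rho>)"

definition clustering ::
  "'b::euclidean_space set \<Rightarrow> ('b \<Rightarrow> real) \<Rightarrow> nat \<Rightarrow> (nat \<Rightarrow> 'b set) \<Rightarrow> bool" where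
  "clustering \<Omega> \<rho> Ny \<omega> \<longleftrightarrow>
     (\<forall>k\<in>{1..Ny}. \<omega> k \<in> sets lborel \<and> bounded (\<omega> k)) \<and>
     (\<forall>j\<in>{1..Ny}. \<forall>k\<in>{1..Ny}. j \<noteq> k \<longrightarrow> measure (param_measure \<Omega> \<rho>) (\<omega> j \<inter> \<omega> k) = 0) \<and>
     \<Omega> = (\<Union>k\<in>{1..Ny}. \<omega> k)"

text \<open>The radius of a set is that of its smallest enclosing ball.\<close>

definition set_radius :: "'b::euclidean_space set \<Rightarrow> real" where
  "set_radius S = Inf {r. 0 \<le> r \<and> (\<exists>c. S \<subseteq> cball c r)}"

definition cluster_size :: "nat \<Rightarrow> (nat \<Rightarrow> 'b::euclidean_space set) \<Rightarrow> real" where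
  "cluster_size Ny \<omega> = (MAX k\<in>{1..Ny}. set_radius (\<omega> k))"

text \<open>The centre of a cell is only required to be a point of that cell, and the number of
  cells may be (countably) infinite.\<close>

definition physical_mesh ::
  "'a::euclidean_space set \<Rightarrow> nat set \<Rightarrow> (nat \<Rightarrow> 'a set) \<Rightarrow> (nat \<Rightarrow> 'a) \<Rightarrow> bool" where
  "physical_mesh D I cell xc \<longleftrightarrow>
     D \<noteq> {} \<and> (\<forall>i\<in>I. cell i \<in> sets lborel \<and> bounded (cell i) \<and> xc i \<in> cell i) \<and>
     disjoint_family_on cell I \<and> D = (\<Union>i\<in>I. cell i) \<and>
     bdd_above ((\<lambda>i. diameter (cell i)) ` I)"

definition mesh_size :: "nat set \<Rightarrow> (nat \<Rightarrow> 'a::euclidean_space set) \<Rightarrow> real" where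
  "mesh_size I cell = (SUP i\<in>I. diameter (cell i))"

definition cell_index :: "nat set \<Rightarrow> (nat \<Rightarrow> 'a set) \<Rightarrow> 'a \<Rightarrow> nat" where
  "cell_index I cell x = (THE i. i \<in> I \<and> x \<in> cell i)"

text \<open>The two measures on \<open>D\<close> that give a meaning to the \<open>L\<^sup>\<infinity>\<close> norms in the physical variable:
  Lebesgue measure gives the usual norm, in which cell values stand for functions that are
  constant on cells, and counting measure on the centres gives the supremum over \<open>i\<close> of the
  values at \<open>x\<^sub>i\<close>.\<close>

definition physical_measures ::
  "'a::euclidean_space set \<Rightarrow> nat set \<Rightarrow> (nat \<Rightarrow> 'a) \<Rightarrow> 'a measure set" where
  "physical_measures D I xc = {restrict_space lborel D, count_space (xc ` I)}"

definition exact_mean ::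
  "'b::euclidean_space set \<Rightarrow> ('b \<Rightarrow> real) \<Rightarrow> ('a \<Rightarrow> real \<Rightarrow> 'b \<Rightarrow> real) \<Rightarrow> 'a \<Rightarrow> real \<Rightarrow> real" where
  "exact_mean \<Omega> \<rho> p x t = (LINT y:\<Omega>|lborel. p x t y * \<rho> y)"

definition exact_variance ::
  "'b::euclidean_space set \<Rightarrow> ('b \<Rightarrow> real) \<Rightarrow> ('a \<Rightarrow> real \<Rightarrow> 'b \<Rightarrow> real) \<Rightarrow> 'a \<Rightarrow> real \<Rightarrow> real" where
  "exact_variance \<Omega> \<rho> p x t =
     exact_mean \<Omega> \<rho> (\<lambda>x t y. (p x t y)\<^sup>2) x t - (exact_mean \<Omega> \<rho> p x t)\<^sup>2"

definition weight :: "('b::euclidean_space \<Rightarrow> real) \<Rightarrow> (nat \<Rightarrow> 'b set) \<Rightarrow> nat \<Rightarrow> real" where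
  "weight \<rho> \<omega> k = (LINT y:\<omega> k|lborel. \<rho> y)"

definition mc_weight :: "nat \<Rightarrow> (nat \<Rightarrow> 'b) \<Rightarrow> (nat \<Rightarrow> 'b set) \<Rightarrow> nat \<Rightarrow> real" where
  "mc_weight N ys \<omega> k = (1 / real N) * (\<Sum>j=1..N. indicator (\<omega> k) (ys j))"

definition cluster_sd ::
  "'b::euclidean_space set \<Rightarrow> ('b \<Rightarrow> real) \<Rightarrow> (nat \<Rightarrow> 'b set) \<Rightarrow> nat \<Rightarrow> real" where
  "cluster_sd \<Omega> \<rho> \<omega> k = sqrt (prob_space.variance (param_measure \<Omega> \<rho>) (indicator (\<omega> k)))"

definition max_cluster_sd ::
  "'b::euclidean_space set \<Rightarrow> ('b \<Rightarrow> real) \<Rightarrow> nat \<Rightarrow> (nat \<Rightarrow> 'b set) \<Rightarrow> real" where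
  "max_cluster_sd \<Omega> \<rho> Ny \<omega> = (MAX k\<in>{1..Ny}. cluster_sd \<Omega> \<rho> \<omega> k)"

text \<open>Below, \<open>P n i k\<close> is the approximate value at the \<open>n\<close>-th time level in physical cell \<open>i\<close> and
  cluster \<open>k\<close>.\<close>

definition sfv_mean ::
  "nat \<Rightarrow> nat \<Rightarrow> (nat \<Rightarrow> 'b set) \<Rightarrow> (nat \<Rightarrow> 'b) \<Rightarrow> (nat \<Rightarrow> nat \<Rightarrow> nat \<Rightarrow> real) \<Rightarrow> nat \<Rightarrow> nat \<Rightarrow> real" where
  "sfv_mean Ny N \<omega> ys P n i = (\<Sum>k=1..Ny. P n i k * mc_weight N ys \<omega> k)"

definition sfv_variance ::
  "nat \<Rightarrow> nat \<Rightarrow> (nat \<Rightarrow> 'b set) \<Rightarrow> (nat \<Rightarrow> 'b) \<Rightarrow> (nat \<Rightarrow> nat \<Rightarrow> nat \<Rightarrow> real) \<Rightarrow> nat \<Rightarrow> nat \<Rightarrow> real" where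
  "sfv_variance Ny N \<omega> ys P n i =
     sfv_mean Ny N \<omega> ys (\<lambda>n i k. (P n i k)\<^sup>2) n i - (sfv_mean Ny N \<omega> ys P n i)\<^sup>2"

text \<open>The function on \<open>D \<times> \<Omega>\<close> with value \<open>P n i k\<close> on \<open>cell i \<times> \<omega> k\<close>. Where clusters overlap, which
  is a null set of parameters, the values add up.\<close>

definition sfv_function ::
  "nat set \<Rightarrow> (nat \<Rightarrow> 'a set) \<Rightarrow> nat \<Rightarrow> (nat \<Rightarrow> 'b set) \<Rightarrow> (nat \<Rightarrow> nat \<Rightarrow> nat \<Rightarrow> real) \<Rightarrow>
     nat \<Rightarrow> 'a \<Rightarrow> 'b \<Rightarrow> real" where
  "sfv_function I cell Ny \<omega> P n x y =
     (\<Sum>k=1..Ny. P n (cell_index I cell x) k * indicator (\<omega> k) y)"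

end

theory Submission
  imports Defs
begin

text \<open>
  Fix a point \<open>x\<close> of the physical domain at which the three \<open>L\<^sup>\<infinity>\<close> hypotheses hold for almost every
  parameter; by Fubini this is almost every point. Write \<open>f = p(x, t; \<cdot>)\<close>, let \<open>h\<close> be the step
  function with value \<open>v\<^sub>k\<close> on \<open>\<omega>\<^sub>k\<close> that the scheme attaches to the cell of \<open>x\<close>, let \<open>\<alpha>\<^sub>k = P(\<omega>\<^sub>k)\<close>
  be the exact and \<open>a\<^sub>k\<close> the sampled weights, and let \<open>\<epsilon>\<close> be the bound for \<open>\<bar>f - h\<bar>\<close>. The error splits
  into an approximation part and a sampling part,
  \<open>E f - (\<Sum>k. v\<^sub>k a\<^sub>k) = E (f - h) + (\<Sum>k. v\<^sub>k (\<alpha>\<^sub>k - a\<^sub>k))\<close>. The first is at most \<open>\<epsilon>\<close>, since \<open>P\<close> is a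
  probability measure. In the second, \<open>\<bar>v\<^sub>k\<bar> \<le> B\<close> on each cluster of positive probability, and the \<open>N\<^sub>y\<close>
  differences are each at most \<open>\<bar>c\<bar> \<sigma> / sqrt N\<close>; so \<open>C\<^sub>3 = B \<bar>c\<bar>\<close>.

  For the variance the same argument, applied to \<open>f\<^sup>2\<close> and \<open>h\<^sup>2\<close>, controls the second moments, because
  \<open>\<bar>f\<^sup>2 - h\<^sup>2\<bar> \<le> (A + B) \<epsilon>\<close>. The squared means differ by the product of their difference, just bounded,
  and their sum. To bound the sum, and so keep terms quadratic in \<open>1 / sqrt N\<close> out of the estimate, the
  sampled mean has to be bounded independently of the discretisation. If the clusters were disjoint,
  the sampled weights would sum to \<open>1\<close>; but clusters may overlap in a null set, a sample in the
  overlap counts several times, and the sampled weights may sum to more than \<open>1\<close>. What saves the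
  estimate is that \<open>N a\<^sub>k\<close> is an integer: a cluster that is hit at all has \<open>N a\<^sub>k \<ge> 1\<close>, and then the
  Monte Carlo bound forces \<open>N \<alpha>\<^sub>k\<close> to be bounded below, so that \<open>a\<^sub>k \<le> (1 + \<bar>c\<bar> + c\<^sup>2) \<alpha>\<^sub>k\<close>
  (lemma \<open>counting_frequency_dominated\<close>). Summing over \<open>k\<close> bounds the sampled mean by
  \<open>B (1 + \<bar>c\<bar> + c\<^sup>2)\<close>.

  The estimates for a fixed \<open>x\<close> are \<open>mean_error\<close> and \<open>variance_error\<close>, proved for an arbitrary finite
  partition of a probability space up to null sets.
\<close>

section \<open>Quadrature errors on a partition up to null sets\<close>

lemma (in prob_space) AE_abs_le_imp_nonneg:
  assumes "AE y in M. \<bar>f y\<bar> \<le> (B :: real)"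
  shows "0 \<le> B"
proof -
  from assms have "AE y in M. 0 \<le> B"
    by eventually_elim linarith
  then show ?thesis
    by simp
qed

lemma (in prob_space) abs_expectation_diff_le:
  assumes [measurable]: "g \<in> borel_measurable M" "h \<in> borel_measurable M"
    and "AE y in M. \<bar>g y\<bar> \<le> (G :: real)" "AE y in M. \<bar>h y\<bar> \<le> (H :: real)"
    and diff: "AE y in M. \<bar>g y - h y\<bar> \<le> \<delta>"
  shows "\<bar>expectation g - expectation h\<bar> \<le> \<delta>"
proof -
  have int: "integrable M g" "integrable M h"
    using assms by (auto intro!: integrable_const_bound)
  have "\<bar>expectation g - expectation h\<bar> = \<bar>expectation (\<lambda>y. g y - h y)\<bar>"
    using int by simp
  also have "\<dots> \<le> expectation (\<lambda>y. \<bar>g y - h y\<bar>)"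
    using integral_norm_bound[of M "\<lambda>y. g y - h y"] by simp
  also have "\<dots> \<le> \<delta>"
    using int diff by (intro integral_le_const) auto
  finally show ?thesis .
qed

text \<open>The cells may overlap in null sets, so a function that is constant on cells is determined only
  almost everywhere. As in \<open>sfv_function\<close>, its values add up on overlaps.\<close>

locale essential_partition = prob_space M
  for M :: "'b measure" +
  fixes K :: "'k set" and \<omega> :: "'k \<Rightarrow> 'b set"
  assumes finite_index: "finite K"
    and cell_sets [measurable]: "\<And>k. k \<in> K \<Longrightarrow> \<omega> k \<in> sets M"
    and null_overlap: "\<And>j k. j \<in> K \<Longrightarrow> k \<in> K \<Longrightarrow> j \<noteq> k \<Longrightarrow> prob (\<omega> j \<inter> \<omega> k) = 0"
    and cover: "space M = (\<Union>k\<in>K. \<omega> k)"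
begin

definition step_fun :: "('k \<Rightarrow> real) \<Rightarrow> 'b \<Rightarrow> real" where
  "step_fun v y = (\<Sum>k\<in>K. v k * indicator (\<omega> k) y)"

lemma step_fun_measurable [measurable]: "step_fun v \<in> borel_measurable M"
  unfolding step_fun_def by measurable

text \<open>Outside the finitely many null overlaps a point lies in one cell only, and the step function
  takes the coefficient of that cell. This reduces almost sure statements about step functions to
  statements about coefficients.\<close>

lemma AE_unique_cell: "AE y in M. \<exists>k\<in>K. y \<in> \<omega> k \<and> (\<forall>v. step_fun v y = v k)"
proof -
  have "AE y in M. y \<notin> \<omega> j \<inter> \<omega> k" if "j \<in> K" "k \<in> K" "j \<noteq> k" for j k
  proof (rule AE_not_in)
    show "\<omega> j \<inter> \<omega> k \<in> null_sets M"
      using that null_overlap[OF that] by (auto simp: null_sets_def emeasure_eq_measure)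
  qed
  then have "AE y in M. \<forall>j\<in>K. \<forall>k\<in>K. j \<noteq> k \<longrightarrow> y \<notin> \<omega> j \<inter> \<omega> k"
    by (intro AE_finite_allI finite_index) (auto intro: AE_I2)
  then show ?thesis
    using AE_space
  proof eventually_elim
    case (elim y)
    then obtain k where k: "k \<in> K" "y \<in> \<omega> k"
      using cover by auto
    have "step_fun v y = v k" for v
    proof -
      have "step_fun v y = (\<Sum>l\<in>K. if l = k then v l else 0)"
        unfolding step_fun_def using elim k by (intro sum.cong) (auto simp: indicator_def)
      then show ?thesis
        using k finite_index by simp
    qed
    then show ?case
      using k by blast
  qed
qed

lemma step_fun_square: "AE y in M. step_fun (\<lambda>k. (v k)\<^sup>2) y = (step_fun v y)\<^sup>2"
  using AE_unique_cell by eventually_elim auto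

lemma expectation_step_fun: "expectation (step_fun v) = (\<Sum>k\<in>K. v k * prob (\<omega> k))"
  unfolding step_fun_def
  by (subst Bochner_Integration.integral_sum)
     (auto intro!: sum.cong simp: less_top[symmetric] Int_absorb2 sets.sets_into_space)

lemma sum_prob_cells: "(\<Sum>k\<in>K. prob (\<omega> k)) = 1"
proof -
  have "expectation (step_fun (\<lambda>_. 1)) = expectation (\<lambda>_. 1)"
    using AE_unique_cell by (intro integral_cong_AE) auto
  then show ?thesis
    by (simp add: expectation_step_fun prob_space)
qed

text \<open>An almost sure bound says nothing about the coefficient of a null cell, hence the condition on
  \<open>prob (\<omega> k)\<close>.\<close>

lemma step_fun_coeff_bound:
  assumes bound: "AE y in M. \<bar>step_fun v y\<bar> \<le> B" and k: "k \<in> K" and pos: "prob (\<omega> k) \<noteq> 0"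
  shows "\<bar>v k\<bar> \<le> B"
proof (rule ccontr)
  assume "\<not> \<bar>v k\<bar> \<le> B"
  have "AE y in M. y \<notin> \<omega> k"
    using AE_unique_cell bound
  proof eventually_elim
    case (elim y)
    then obtain j where j: "j \<in> K" "y \<in> \<omega> j" "\<And>v. step_fun v y = v j"
      by blast
    \<comment> \<open>Evaluating the step function with coefficients \<open>1\<close> at \<open>k\<close> and \<open>0\<close> elsewhere detects \<open>j\<close>.\<close>
    show ?case
    proof
      assume "y \<in> \<omega> k"
      have "step_fun (\<lambda>l. if l = k then 1 else 0) y = (\<Sum>l\<in>K. if l = k then 1 else 0)"
        unfolding step_fun_def using \<open>y \<in> \<omega> k\<close> by (intro sum.cong) auto
      then have "j = k"
        using k finite_index by (simp add: j(3) split: if_splits)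
      then show False
        using elim \<open>\<not> \<bar>v k\<bar> \<le> B\<close> by (simp add: j(3))
    qed
  qed
  then have "prob (\<omega> k) = 0"
    using k by (simp add: prob_eq_0)
  then show False
    using pos by simp
qed

text \<open>
  Here \<open>f\<close> is to be integrated, \<open>v\<close> are the coefficients of an approximating step function, and \<open>a\<close>
  are approximate weights for the cells. The domination of \<open>a\<close> by \<open>\<kappa>\<close> times the exact weights serves
  two purposes: null cells get weight \<open>0\<close>, so that their uncontrolled coefficients do no harm, and the
  approximate mean is bounded (\<open>weighted_mean_bound\<close>).
\<close>

context
  fixes f :: "'b \<Rightarrow> real" and v a :: "'k \<Rightarrow> real" and A B \<epsilon> \<kappa> :: real
  assumes f_measurable [measurable]: "f \<in> borel_measurable M"
    and f_bound: "AE y in M. \<bar>f y\<bar> \<le> A"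
    and v_bound: "AE y in M. \<bar>step_fun v y\<bar> \<le> B"
    and approx: "AE y in M. \<bar>f y - step_fun v y\<bar> \<le> \<epsilon>"
    and a_nonneg: "\<And>k. k \<in> K \<Longrightarrow> 0 \<le> a k"
    and a_dominated: "\<And>k. k \<in> K \<Longrightarrow> a k \<le> \<kappa> * prob (\<omega> k)"
begin

lemma a_null: "k \<in> K \<Longrightarrow> prob (\<omega> k) = 0 \<Longrightarrow> a k = 0"
  using a_nonneg[of k] a_dominated[of k] by simp

lemma nonneg: "0 \<le> A" "0 \<le> B" "0 \<le> \<epsilon>"
  using f_bound v_bound approx by (auto intro: AE_abs_le_imp_nonneg)

lemma weight_change:
  assumes "\<And>k. k \<in> K \<Longrightarrow> prob (\<omega> k) \<noteq> 0 \<Longrightarrow> \<bar>w k\<bar> \<le> W"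
  shows "\<bar>(\<Sum>k\<in>K. w k * prob (\<omega> k)) - (\<Sum>k\<in>K. w k * a k)\<bar> \<le> W * (\<Sum>k\<in>K. \<bar>prob (\<omega> k) - a k\<bar>)"
proof -
  have "(\<Sum>k\<in>K. w k * prob (\<omega> k)) - (\<Sum>k\<in>K. w k * a k) = (\<Sum>k\<in>K. w k * (prob (\<omega> k) - a k))"
    by (simp add: sum_subtractf right_diff_distrib)
  also have "\<bar>\<dots>\<bar> \<le> (\<Sum>k\<in>K. \<bar>w k * (prob (\<omega> k) - a k)\<bar>)"
    by (rule sum_abs)
  also have "\<dots> \<le> (\<Sum>k\<in>K. W * \<bar>prob (\<omega> k) - a k\<bar>)"
  proof (rule sum_mono)
    fix k assume "k \<in> K"
    then show "\<bar>w k * (prob (\<omega> k) - a k)\<bar> \<le> W * \<bar>prob (\<omega> k) - a k\<bar>"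
      using assms[of k] a_null[of k]
      by (cases "prob (\<omega> k) = 0") (auto simp: abs_mult intro: mult_right_mono)
  qed
  finally show ?thesis
    by (simp add: sum_distrib_left)
qed

lemma v_coeff_bound: "k \<in> K \<Longrightarrow> prob (\<omega> k) \<noteq> 0 \<Longrightarrow> \<bar>v k\<bar> \<le> B"
  by (rule step_fun_coeff_bound[OF v_bound])

lemma mean_error:
  "\<bar>expectation f - (\<Sum>k\<in>K. v k * a k)\<bar> \<le> \<epsilon> + B * (\<Sum>k\<in>K. \<bar>prob (\<omega> k) - a k\<bar>)"
proof -
  have "\<bar>expectation f - expectation (step_fun v)\<bar> \<le> \<epsilon>"
    using f_bound v_bound approx by (intro abs_expectation_diff_le) auto
  moreover have "\<bar>(\<Sum>k\<in>K. v k * prob (\<omega> k)) - (\<Sum>k\<in>K. v k * a k)\<bar>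
      \<le> B * (\<Sum>k\<in>K. \<bar>prob (\<omega> k) - a k\<bar>)"
    by (rule weight_change) (rule v_coeff_bound)
  ultimately show ?thesis
    by (simp add: expectation_step_fun)
qed

text \<open>This is \<open>mean_error\<close> for \<open>f\<^sup>2\<close>: the square of a step function is, almost everywhere, the step
  function with squared coefficients, and \<open>f\<^sup>2 - h\<^sup>2 = (f + h) (f - h)\<close>.\<close>

lemma second_moment_error:
  "\<bar>expectation (\<lambda>y. (f y)\<^sup>2) - (\<Sum>k\<in>K. (v k)\<^sup>2 * a k)\<bar>
     \<le> (A + B) * \<epsilon> + B\<^sup>2 * (\<Sum>k\<in>K. \<bar>prob (\<omega> k) - a k\<bar>)"
proof -
  have "\<bar>expectation (\<lambda>y. (f y)\<^sup>2) - expectation (step_fun (\<lambda>k. (v k)\<^sup>2))\<bar> \<le> (A + B) * \<epsilon>"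
  proof (rule abs_expectation_diff_le)
    show "AE y in M. \<bar>(f y)\<^sup>2\<bar> \<le> A\<^sup>2"
      using f_bound by eventually_elim (auto simp: abs_le_square_iff[symmetric])
    show "AE y in M. \<bar>step_fun (\<lambda>k. (v k)\<^sup>2) y\<bar> \<le> B\<^sup>2"
      using v_bound step_fun_square[of v] by eventually_elim (auto simp: abs_le_square_iff[symmetric])
    show "AE y in M. \<bar>(f y)\<^sup>2 - step_fun (\<lambda>k. (v k)\<^sup>2) y\<bar> \<le> (A + B) * \<epsilon>"
      using f_bound v_bound approx step_fun_square[of v]
    proof eventually_elim
      case (elim y)
      have "\<bar>(f y)\<^sup>2 - (step_fun v y)\<^sup>2\<bar> = \<bar>f y + step_fun v y\<bar> * \<bar>f y - step_fun v y\<bar>"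
        by (simp add: power2_eq_square square_diff_square_factored abs_mult)
      also have "\<dots> \<le> (A + B) * \<epsilon>"
        using elim by (intro mult_mono) auto
      finally show ?case
        using elim by simp
    qed
  qed auto
  moreover have "\<bar>(\<Sum>k\<in>K. (v k)\<^sup>2 * prob (\<omega> k)) - (\<Sum>k\<in>K. (v k)\<^sup>2 * a k)\<bar>
      \<le> B\<^sup>2 * (\<Sum>k\<in>K. \<bar>prob (\<omega> k) - a k\<bar>)"
  proof (rule weight_change)
    fix k assume "k \<in> K" "prob (\<omega> k) \<noteq> 0"
    then show "\<bar>(v k)\<^sup>2\<bar> \<le> B\<^sup>2"
      using v_coeff_bound[of k] by (auto simp: abs_le_square_iff[symmetric])
  qed
  ultimately show ?thesis
    by (simp add: expectation_step_fun)
qed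

lemma weighted_mean_bound: "\<bar>\<Sum>k\<in>K. v k * a k\<bar> \<le> B * \<kappa>"
proof -
  have "\<bar>\<Sum>k\<in>K. v k * a k\<bar> \<le> (\<Sum>k\<in>K. \<bar>v k * a k\<bar>)"
    by (rule sum_abs)
  also have "\<dots> \<le> (\<Sum>k\<in>K. B * (\<kappa> * prob (\<omega> k)))"
  proof (rule sum_mono)
    fix k assume k: "k \<in> K"
    show "\<bar>v k * a k\<bar> \<le> B * (\<kappa> * prob (\<omega> k))"
    proof (cases "prob (\<omega> k) = 0")
      case True
      then show ?thesis
        using a_null[OF k] by simp
    next
      case False
      then show ?thesis
        using k a_nonneg[OF k] a_dominated[OF k] v_coeff_bound[OF k] nonneg
        by (auto simp: abs_mult intro!: mult_mono)
    qed
  qed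
  also have "\<dots> = B * \<kappa>"
    using sum_prob_cells by (simp add: sum_distrib_left[symmetric])
  finally show ?thesis .
qed

text \<open>The difference of the squared means is the product of their difference, bounded in \<open>mean_error\<close>,
  and their sum, bounded by \<open>A + B * \<kappa>\<close>. Using \<open>B * \<kappa>\<close> for the approximate mean keeps the bound linear
  in the error of the weights.\<close>

lemma variance_error:
  "\<bar>(expectation (\<lambda>y. (f y)\<^sup>2) - (expectation f)\<^sup>2)
      - ((\<Sum>k\<in>K. (v k)\<^sup>2 * a k) - (\<Sum>k\<in>K. v k * a k)\<^sup>2)\<bar>
     \<le> (2 * A + B + B * \<kappa>) * \<epsilon> + (B\<^sup>2 + B * (A + B * \<kappa>)) * (\<Sum>k\<in>K. \<bar>prob (\<omega> k) - a k\<bar>)"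
proof -
  define s where "s = (\<Sum>k\<in>K. \<bar>prob (\<omega> k) - a k\<bar>)"
  have s: "0 \<le> s"
    by (simp add: s_def sum_nonneg)
  define m where "m = (\<Sum>k\<in>K. v k * a k)"
  have mean: "\<bar>expectation f - m\<bar> \<le> \<epsilon> + B * s"
    using mean_error by (simp add: s_def m_def)
  have "\<bar>expectation f - expectation (\<lambda>_. 0)\<bar> \<le> A"
    by (rule abs_expectation_diff_le[where H = 0]) (use f_bound in auto)
  moreover have "\<bar>m\<bar> \<le> B * \<kappa>"
    using weighted_mean_bound by (simp add: m_def)
  ultimately have sum: "\<bar>expectation f + m\<bar> \<le> A + B * \<kappa>"
    by simp
  have "\<bar>(expectation f)\<^sup>2 - m\<^sup>2\<bar> = \<bar>expectation f + m\<bar> * \<bar>expectation f - m\<bar>"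
    by (simp add: power2_eq_square square_diff_square_factored abs_mult)
  also have "\<dots> \<le> (A + B * \<kappa>) * (\<epsilon> + B * s)"
    using sum mean by (intro mult_mono) auto
  finally have "\<bar>(expectation f)\<^sup>2 - m\<^sup>2\<bar> \<le> (A + B * \<kappa>) * (\<epsilon> + B * s)" .
  moreover have "\<bar>expectation (\<lambda>y. (f y)\<^sup>2) - (\<Sum>k\<in>K. (v k)\<^sup>2 * a k)\<bar> \<le> (A + B) * \<epsilon> + B\<^sup>2 * s"
    using second_moment_error by (simp add: s_def)
  ultimately show ?thesis
    unfolding s_def[symmetric] m_def[symmetric] by (simp add: algebra_simps)
qed

end

end

section \<open>Sampling frequencies are dominated by probabilities\<close>

text \<open>
  With \<open>x = sqrt (N \<alpha>)\<close> the hypothesis gives \<open>m \<le> x\<^sup>2 + c x\<close>. A positive integer \<open>m\<close> is at least \<open>1\<close>,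
  so \<open>x\<close> cannot be small: whether \<open>x \<ge> 1\<close> or \<open>x < 1\<close>, it follows that \<open>x \<le> (1 + c) x\<^sup>2\<close>, and the linear
  term is absorbed into the quadratic one. For a real number \<open>m\<close> this would fail as \<open>\<alpha>\<close> tends to \<open>0\<close>.
\<close>

lemma counting_frequency_dominated:
  fixes \<alpha> c :: real and m N :: nat
  assumes N: "N \<ge> 1" and c: "0 \<le> c" and \<alpha>: "0 \<le> \<alpha>"
    and close: "\<bar>\<alpha> - real m / real N\<bar> \<le> c * (sqrt \<alpha> / sqrt (real N))"
  shows "real m / real N \<le> (1 + c + c\<^sup>2) * \<alpha>"
proof -
  define x where "x = sqrt (real N * \<alpha>)"
  have x: "0 \<le> x" "x\<^sup>2 = real N * \<alpha>"
    using \<alpha> by (auto simp: x_def)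
  have "real N * (c * (sqrt \<alpha> / sqrt (real N))) = c * (sqrt \<alpha> * (real N / sqrt (real N)))"
    by simp
  also have "\<dots> = c * x"
    by (simp add: real_div_sqrt x_def real_sqrt_mult)
  finally have "real N * (c * (sqrt \<alpha> / sqrt (real N))) = c * x" .
  moreover have "real m / real N \<le> \<alpha> + c * (sqrt \<alpha> / sqrt (real N))"
    using close by linarith
  then have "real N * (real m / real N) \<le> real N * (\<alpha> + c * (sqrt \<alpha> / sqrt (real N)))"
    by (rule mult_left_mono) simp
  ultimately have m: "real m \<le> x\<^sup>2 + c * x"
    using N x(2) by (simp add: distrib_left)
  have "real m \<le> (1 + c + c\<^sup>2) * x\<^sup>2"
  proof (cases "m = 0")
    case True
    then show ?thesis
      using c by simp
  next
    case False
    then have one: "1 \<le> x\<^sup>2 + c * x"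
      using m by linarith
    have "x \<le> (1 + c) * x\<^sup>2"
    proof (cases "1 \<le> x")
      case True
      then have "x * 1 \<le> x * x"
        by (intro mult_left_mono) auto
      also have "\<dots> \<le> (1 + c) * x\<^sup>2"
        using c by (simp add: power2_eq_square algebra_simps)
      finally show ?thesis
        by simp
    next
      case False
      then have "x * x \<le> 1 * x"
        using x by (intro mult_right_mono) auto
      then have "1 \<le> (1 + c) * x"
        using one by (simp add: power2_eq_square algebra_simps)
      then have "x * 1 \<le> x * ((1 + c) * x)"
        using x by (intro mult_left_mono) auto
      then show ?thesis
        by (simp add: power2_eq_square algebra_simps)
    qed
    then have "c * x \<le> c * ((1 + c) * x\<^sup>2)"
      using c by (rule mult_left_mono)
    then show ?thesis
      using m by (simp add: power2_eq_square algebra_simps)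
  qed
  then show ?thesis
    using N x(2) by (simp add: field_simps)
qed

section \<open>The essential supremum as an almost sure bound\<close>

lemma Linf_norm_le_imp_AE:
  assumes "Linf_norm M f \<le> ereal e"
  shows "AE z in M. \<bar>f z\<bar> \<le> e"
proof -
  have "AE z in M. ereal \<bar>f z\<bar> \<le> Linf_norm M f"
    unfolding Linf_norm_def by (rule esssup_AE)
  then show ?thesis
    by eventually_elim (use assms in \<open>metis ereal_less_eq(3) order_trans\<close>)
qed

lemma Linf_norm_leI:
  assumes [measurable]: "f \<in> borel_measurable M" and "AE z in M. \<bar>f z\<bar> \<le> e"
  shows "Linf_norm M f \<le> ereal e"
  unfolding Linf_norm_def by (rule esssup_I) (use assms in auto)

section \<open>The parameter measure and the cluster weights\<close>

lemma space_param_measure: "space (param_measure \<Omega> \<rho>) = \<Omega>"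
  by (simp add: param_measure_def space_restrict_space)

lemma sets_param_measure: "sets (param_measure \<Omega> \<rho>) = sets (restrict_space lborel \<Omega>)"
  by (simp add: param_measure_def)

lemma integral_param_measure:
  assumes "prob_density_on \<Omega> \<rho>" and "f \<in> borel_measurable (param_measure \<Omega> \<rho>)"
  shows "(LINT y|param_measure \<Omega> \<rho>. f y) = (LINT y:\<Omega>|lborel. f y * \<rho> y)"
proof -
  have "(LINT y|param_measure \<Omega> \<rho>. f y) = (LINT y|restrict_space lborel \<Omega>. \<rho> y *\<^sub>R f y)"
    unfolding param_measure_def
    using assms by (intro integral_density)
      (auto simp: prob_density_on_def param_measure_def space_restrict_space)
  also have "\<dots> = (LINT y:\<Omega>|lborel. f y * \<rho> y)"
    using assms unfolding set_lebesgue_integral_def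
    by (subst integral_restrict_space) (auto simp: prob_density_on_def mult.commute)
  finally show ?thesis .
qed

lemma clustering_essential_partition:
  assumes "prob_density_on \<Omega> \<rho>" "clustering \<Omega> \<rho> Ny \<omega>"
  shows "essential_partition (param_measure \<Omega> \<rho>) {1..Ny} \<omega>"
proof -
  interpret prob_space "param_measure \<Omega> \<rho>"
    using assms by (simp add: prob_density_on_def)
  show ?thesis
  proof
    fix k assume "k \<in> {1..Ny}"
    then show "\<omega> k \<in> sets (param_measure \<Omega> \<rho>)"
      using assms by (subst sets_param_measure, subst sets_restrict_space_iff)
        (auto simp: clustering_def prob_density_on_def)
  qed (use assms in \<open>auto simp: clustering_def space_param_measure\<close>)
qed

lemma weight_eq_measure:
  assumes "prob_density_on \<Omega> \<rho>" and "\<omega> k \<in> sets (param_measure \<Omega> \<rho>)"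
  shows "weight \<rho> \<omega> k = measure (param_measure \<Omega> \<rho>) (\<omega> k)"
proof -
  have sub: "\<omega> k \<subseteq> \<Omega>"
    using sets.sets_into_space[OF assms(2)] by (simp add: space_param_measure)
  have "measure (param_measure \<Omega> \<rho>) (\<omega> k) = (LINT y|param_measure \<Omega> \<rho>. indicator (\<omega> k) y)"
    using sub by (simp add: space_param_measure Int_absorb2)
  also have "\<dots> = (LINT y:\<Omega>|lborel. indicator (\<omega> k) y * \<rho> y)"
    using assms by (intro integral_param_measure) auto
  also have "\<dots> = weight \<rho> \<omega> k"
    unfolding weight_def set_lebesgue_integral_def
    using sub by (intro Bochner_Integration.integral_cong) (auto simp: indicator_def)
  finally show ?thesis by simp
qed

lemma exact_mean_eq_expectation:
  assumes "prob_density_on \<Omega> \<rho>" and "p x t \<in> borel_measurable (param_measure \<Omega> \<rho>)"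
  shows "exact_mean \<Omega> \<rho> p x t = (LINT y|param_measure \<Omega> \<rho>. p x t y)"
  using integral_param_measure[OF assms] by (simp add: exact_mean_def)

text \<open>The variance of the indicator is \<open>\<alpha> - \<alpha>\<^sup>2 \<le> \<alpha>\<close>. The square root of the cluster probability has the
  right order of decay for \<open>counting_frequency_dominated\<close>.\<close>

lemma cluster_sd_bounds:
  assumes "prob_density_on \<Omega> \<rho>" and "\<omega> k \<in> sets (param_measure \<Omega> \<rho>)"
  shows "0 \<le> cluster_sd \<Omega> \<rho> \<omega> k"
    and "cluster_sd \<Omega> \<rho> \<omega> k \<le> sqrt (measure (param_measure \<Omega> \<rho>) (\<omega> k))"
proof -
  interpret prob_space "param_measure \<Omega> \<rho>"
    using assms by (simp add: prob_density_on_def)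
  let ?X = "indicator (\<omega> k) :: 'a \<Rightarrow> real"
  have sq: "(\<lambda>y. (?X y)\<^sup>2) = ?X"
    by (auto simp: indicator_def)
  have int: "integrable (param_measure \<Omega> \<rho>) ?X"
    using assms by (simp add: less_top[symmetric])
  have "variance ?X = expectation ?X - (expectation ?X)\<^sup>2"
    using int by (subst variance_eq) (simp_all only: sq)
  also have "\<dots> \<le> prob (\<omega> k)"
    using assms(2)[THEN sets.sets_into_space] by (simp add: Int_absorb2)
  finally show "cluster_sd \<Omega> \<rho> \<omega> k \<le> sqrt (prob (\<omega> k))"
    unfolding cluster_sd_def by simp
  show "0 \<le> cluster_sd \<Omega> \<rho> \<omega> k"
    unfolding cluster_sd_def by (intro real_sqrt_ge_zero integral_nonneg) auto
qed

lemma mc_weight_eq_frequency: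
  "mc_weight N ys \<omega> k = real (card {j\<in>{1..N}. ys j \<in> \<omega> k}) / real N"
proof -
  have "(\<Sum>j=1..N. indicator (\<omega> k) (ys j) :: real) = (\<Sum>j=1..N. if ys j \<in> \<omega> k then 1 else 0)"
    by (intro sum.cong) auto
  then show ?thesis
    by (simp add: mc_weight_def sum.If_cases Int_def)
qed

section \<open>Measurability in the physical variable\<close>

lemma cell_index_eq:
  assumes "disjoint_family_on cell I" "i \<in> I" "x \<in> cell i"
  shows "cell_index I cell x = i"
  unfolding cell_index_def
  using assms by (intro the_equality) (auto simp: disjoint_family_on_def)

lemma physical_mesh_sets:
  assumes "physical_mesh D I cell xc"
  shows "D \<in> sets lborel"
proof -
  have "(\<Union>i\<in>I. cell i) \<in> sets lborel"
    using assms by (intro sets.countable_UN'') (auto simp: physical_mesh_def)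
  then show ?thesis
    using assms by (simp add: physical_mesh_def)
qed

text \<open>There are countably many cells, so it suffices that each level set, which is a cell, is measurable.
  Every quantity that depends on \<open>x\<close> only through its cell is then measurable too.\<close>

lemma cell_index_measurable:
  assumes "physical_mesh D I cell xc"
  shows "cell_index I cell \<in> restrict_space lborel D \<rightarrow>\<^sub>M count_space I"
proof -
  have mesh: "disjoint_family_on cell I" "D = (\<Union>i\<in>I. cell i)" "\<And>i. i \<in> I \<Longrightarrow> cell i \<in> sets lborel"
    using assms by (auto simp: physical_mesh_def)
  show ?thesis
    unfolding measurable_count_space_eq2_countable
  proof safe
    fix x assume "x \<in> space (restrict_space lborel D)"
    then show "cell_index I cell x \<in> I"
      using mesh cell_index_eq by (fastforce simp: space_restrict_space)
  next
    fix i assume i: "i \<in> I"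
    have "cell_index I cell -` {i} \<inter> space (restrict_space lborel D) = cell i"
      using mesh(1,2) i cell_index_eq[OF mesh(1)] by (auto simp: space_restrict_space)
    then show "cell_index I cell -` {i} \<inter> space (restrict_space lborel D)
        \<in> sets (restrict_space lborel D)"
      using mesh i physical_mesh_sets[OF assms] by (auto simp: sets_restrict_space_iff)
  qed
qed

text \<open>What the two measures that give a meaning to the norms over \<open>D\<close> have in common, so that the proof
  need not distinguish them.\<close>

lemma physical_measure_properties:
  assumes mesh: "physical_mesh D I cell xc" and \<mu>: "\<mu> \<in> physical_measures D I xc"
  shows "sigma_finite_measure \<mu>" and "space \<mu> \<subseteq> D"
    and "f \<in> borel_measurable (restrict_space lborel D) \<Longrightarrow> f \<in> borel_measurable \<mu>"
proof -
  have "\<mu> = restrict_space lborel D \<or> \<mu> = count_space (xc ` I)"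
    using \<mu> by (auto simp: physical_measures_def)
  then show "sigma_finite_measure \<mu>"
    using physical_mesh_sets[OF mesh]
    by (auto intro!: sigma_finite_measure_count_space_countable
        sigma_finite_measure_restrict_space sigma_finite_lborel)
  have "xc ` I \<subseteq> D"
    using mesh by (fastforce simp only: physical_mesh_def)
  then show "space \<mu> \<subseteq> D"
    using \<mu> by (auto simp: physical_measures_def space_restrict_space)
  show "f \<in> borel_measurable (restrict_space lborel D) \<Longrightarrow> f \<in> borel_measurable \<mu>"
    using \<mu> by (auto simp: physical_measures_def)
qed

lemma sfv_mean_measurable:
  assumes "physical_mesh D I cell xc"
  shows "(\<lambda>x. sfv_mean Ny N \<omega> ys P n (cell_index I cell x)) \<in> borel_measurable (restrict_space lborel D)"
  by (rule measurable_compose[OF cell_index_measurable[OF assms]]) simp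

lemma sfv_variance_measurable:
  assumes "physical_mesh D I cell xc"
  shows "(\<lambda>x. sfv_variance Ny N \<omega> ys P n (cell_index I cell x))
    \<in> borel_measurable (restrict_space lborel D)"
  by (rule measurable_compose[OF cell_index_measurable[OF assms]]) simp

lemma exact_mean_measurable:
  assumes \<rho>: "prob_density_on \<Omega> \<rho>"
    and p: "(\<lambda>(x, y). p x t y) \<in> borel_measurable (restrict_space lborel D \<Otimes>\<^sub>M param_measure \<Omega> \<rho>)"
  shows "(\<lambda>x. exact_mean \<Omega> \<rho> p x t) \<in> borel_measurable (restrict_space lborel D)"
proof -
  interpret prob_space "param_measure \<Omega> \<rho>"
    using \<rho> by (simp add: prob_density_on_def)
  have "p x t \<in> borel_measurable (param_measure \<Omega> \<rho>)" if "x \<in> space (restrict_space lborel D)" for x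
    using measurable_Pair2[OF p that] by simp
  then have "exact_mean \<Omega> \<rho> p x t = expectation (p x t)" if "x \<in> space (restrict_space lborel D)" for x
    using that by (intro exact_mean_eq_expectation[OF \<rho>])
  then show ?thesis
    using borel_measurable_lebesgue_integral[OF p] by (simp cong: measurable_cong)
qed

lemma exact_variance_measurable:
  assumes \<rho>: "prob_density_on \<Omega> \<rho>"
    and p: "(\<lambda>(x, y). p x t y) \<in> borel_measurable (restrict_space lborel D \<Otimes>\<^sub>M param_measure \<Omega> \<rho>)"
  shows "(\<lambda>x. exact_variance \<Omega> \<rho> p x t) \<in> borel_measurable (restrict_space lborel D)"
proof -
  have "(\<lambda>(x, y). (p x t y)\<^sup>2) \<in> borel_measurable (restrict_space lborel D \<Otimes>\<^sub>M param_measure \<Omega> \<rho>)"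
    using borel_measurable_power[OF p, of 2] by (simp add: case_prod_beta')
  then show ?thesis
    unfolding exact_variance_def
    by (intro borel_measurable_diff borel_measurable_power
        exact_mean_measurable[where p = "\<lambda>x t y. (p x t y)\<^sup>2"] exact_mean_measurable p \<rho>)
qed

section \<open>The error estimates\<close>

text \<open>
  The abstract estimates applied to the clusters and to a section of \<open>p\<close>. Since \<open>c\<close> may be negative, its
  modulus enters the constants.
\<close>

lemma sfv_errors_at_point:
  fixes A B c \<epsilon> :: real
  defines "\<kappa> \<equiv> 1 + \<bar>c\<bar> + \<bar>c\<bar>\<^sup>2"
  assumes \<rho>: "prob_density_on \<Omega> \<rho>" and \<omega>: "clustering \<Omega> \<rho> Ny \<omega>" and N: "N \<ge> 1"
    and meas: "p x t \<in> borel_measurable (param_measure \<Omega> \<rho>)"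
    and A: "AE y in param_measure \<Omega> \<rho>. \<bar>p x t y\<bar> \<le> A"
    and B: "AE y in param_measure \<Omega> \<rho>. \<bar>sfv_function I cell Ny \<omega> P n x y\<bar> \<le> B"
    and \<epsilon>: "AE y in param_measure \<Omega> \<rho>. \<bar>p x t y - sfv_function I cell Ny \<omega> P n x y\<bar> \<le> \<epsilon>"
    and weights: "\<And>k. k \<in> {1..Ny} \<Longrightarrow>
      \<bar>weight \<rho> \<omega> k - mc_weight N ys \<omega> k\<bar> \<le> c * (cluster_sd \<Omega> \<rho> \<omega> k / sqrt (real N))"
  shows "\<bar>exact_mean \<Omega> \<rho> p x t - sfv_mean Ny N \<omega> ys P n (cell_index I cell x)\<bar>
      \<le> \<epsilon> + B * \<bar>c\<bar> * (max_cluster_sd \<Omega> \<rho> Ny \<omega> * real Ny / sqrt (real N))" (is ?mean)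
    and "\<bar>exact_variance \<Omega> \<rho> p x t - sfv_variance Ny N \<omega> ys P n (cell_index I cell x)\<bar>
      \<le> (2 * A + B + B * \<kappa>) * \<epsilon>
         + (B\<^sup>2 + B * (A + B * \<kappa>)) * \<bar>c\<bar> * (max_cluster_sd \<Omega> \<rho> Ny \<omega> * real Ny / sqrt (real N))"
      (is ?variance)
proof -
  interpret Q: essential_partition "param_measure \<Omega> \<rho>" "{1..Ny}" \<omega>
    by (rule clustering_essential_partition[OF \<rho> \<omega>])
  define v where "v = P n (cell_index I cell x)"
  define a where "a = mc_weight N ys \<omega>"
  define \<sigma> where "\<sigma> = max_cluster_sd \<Omega> \<rho> Ny \<omega>"
  define s where "s = (\<Sum>k=1..Ny. \<bar>Q.prob (\<omega> k) - a k\<bar>)"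
  have step: "sfv_function I cell Ny \<omega> P n x = Q.step_fun v"
    by (rule ext) (simp only: sfv_function_def Q.step_fun_def v_def)
  have weight: "weight \<rho> \<omega> k = Q.prob (\<omega> k)" if "k \<in> {1..Ny}" for k
    using \<rho> Q.cell_sets[OF that] by (rule weight_eq_measure)
  have sd: "0 \<le> cluster_sd \<Omega> \<rho> \<omega> k" "cluster_sd \<Omega> \<rho> \<omega> k \<le> sqrt (Q.prob (\<omega> k))"
    if "k \<in> {1..Ny}" for k
    using cluster_sd_bounds[where \<omega> = \<omega>, OF \<rho> Q.cell_sets[OF that]] by auto
  have close: "\<bar>Q.prob (\<omega> k) - a k\<bar> \<le> \<bar>c\<bar> * (cluster_sd \<Omega> \<rho> \<omega> k / sqrt (real N))"
    if "k \<in> {1..Ny}" for k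
  proof -
    have "\<bar>Q.prob (\<omega> k) - a k\<bar> \<le> c * (cluster_sd \<Omega> \<rho> \<omega> k / sqrt (real N))"
      using weights[OF that] by (simp add: weight[OF that] a_def)
    also have "\<dots> \<le> \<bar>c\<bar> * (cluster_sd \<Omega> \<rho> \<omega> k / sqrt (real N))"
      using sd[OF that] by (intro mult_right_mono) auto
    finally show ?thesis .
  qed
  have nonneg: "0 \<le> a k" for k
    by (simp add: a_def mc_weight_eq_frequency)
  have dominated: "a k \<le> \<kappa> * Q.prob (\<omega> k)" if "k \<in> {1..Ny}" for k
    unfolding a_def mc_weight_eq_frequency \<kappa>_def
  proof (rule counting_frequency_dominated[OF N])
    have "\<bar>c\<bar> * (cluster_sd \<Omega> \<rho> \<omega> k / sqrt (real N)) \<le> \<bar>c\<bar> * (sqrt (Q.prob (\<omega> k)) / sqrt (real N))"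
      using sd[OF that] by (intro mult_left_mono divide_right_mono) auto
    then show "\<bar>Q.prob (\<omega> k) - real (card {j \<in> {1..N}. ys j \<in> \<omega> k}) / real N\<bar>
        \<le> \<bar>c\<bar> * (sqrt (Q.prob (\<omega> k)) / sqrt (real N))"
      using close[OF that] by (simp add: a_def mc_weight_eq_frequency)
  qed auto
  have s: "s \<le> \<bar>c\<bar> * (\<sigma> * real Ny / sqrt (real N))"
  proof -
    have "s \<le> (\<Sum>k=1..Ny. \<bar>c\<bar> * (\<sigma> / sqrt (real N)))"
      unfolding s_def
    proof (rule sum_mono)
      fix k assume k: "k \<in> {1..Ny}"
      then have "cluster_sd \<Omega> \<rho> \<omega> k \<le> \<sigma>"
        unfolding \<sigma>_def max_cluster_sd_def by (intro Max_ge) auto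
      then have "\<bar>c\<bar> * (cluster_sd \<Omega> \<rho> \<omega> k / sqrt (real N)) \<le> \<bar>c\<bar> * (\<sigma> / sqrt (real N))"
        by (intro mult_left_mono divide_right_mono) auto
      then show "\<bar>Q.prob (\<omega> k) - a k\<bar> \<le> \<bar>c\<bar> * (\<sigma> / sqrt (real N))"
        using close[OF k] by linarith
    qed
    then show ?thesis
      by (simp add: mult_ac)
  qed
  note hyps = meas A B[unfolded step] \<epsilon>[unfolded step] nonneg dominated
  have AB: "0 \<le> A" "0 \<le> B"
    using A B by (auto intro: Q.AE_abs_le_imp_nonneg)
  have mean: "exact_mean \<Omega> \<rho> p x t = Q.expectation (p x t)"
    by (rule exact_mean_eq_expectation[where p = p, OF \<rho> meas])
  have moment: "exact_mean \<Omega> \<rho> (\<lambda>x t y. (p x t y)\<^sup>2) x t = Q.expectation (\<lambda>y. (p x t y)\<^sup>2)"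
    using meas by (intro exact_mean_eq_expectation[OF \<rho>]) simp
  have "\<bar>exact_mean \<Omega> \<rho> p x t - sfv_mean Ny N \<omega> ys P n (cell_index I cell x)\<bar> \<le> \<epsilon> + B * s"
    using Q.mean_error[OF hyps] by (simp add: mean sfv_mean_def v_def a_def s_def)
  also have "\<dots> \<le> \<epsilon> + B * (\<bar>c\<bar> * (\<sigma> * real Ny / sqrt (real N)))"
    using s AB by (intro add_left_mono mult_left_mono)
  finally show ?mean
    by (simp add: \<sigma>_def mult.assoc)
  have \<kappa>: "0 \<le> \<kappa>"
    by (simp add: \<kappa>_def)
  have "\<bar>exact_variance \<Omega> \<rho> p x t - sfv_variance Ny N \<omega> ys P n (cell_index I cell x)\<bar>
      \<le> (2 * A + B + B * \<kappa>) * \<epsilon> + (B\<^sup>2 + B * (A + B * \<kappa>)) * s"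
    using Q.variance_error[OF hyps]
    by (simp add: exact_variance_def sfv_variance_def mean moment sfv_mean_def v_def a_def s_def)
  also have "\<dots> \<le> (2 * A + B + B * \<kappa>) * \<epsilon>
      + (B\<^sup>2 + B * (A + B * \<kappa>)) * (\<bar>c\<bar> * (\<sigma> * real Ny / sqrt (real N)))"
    using s AB \<kappa> by (intro add_left_mono mult_left_mono) auto
  finally show ?variance
    by (simp add: \<sigma>_def mult.assoc)
qed

(* A and B bound the L^infinity norms of p and p_h, and c is the constant hidden in the bound on the
   Monte Carlo weight error. C3, C1', C2', C3' are chosen before the problem and its discretisation. *)
theorem theorem4p1:
  fixes A B C1 C2 c q r :: real
  shows "\<exists>C3 C1' C2' C3' :: real.
    \<forall>(D :: 'a::euclidean_space set) (\<Omega> :: 'b::euclidean_space set) (\<rho> :: 'b \<Rightarrow> real)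
      (p :: 'a \<Rightarrow> real \<Rightarrow> 'b \<Rightarrow> real) (I :: nat set) (cell :: nat \<Rightarrow> 'a set) (xc :: nat \<Rightarrow> 'a)
      (Ny :: nat) (\<omega> :: nat \<Rightarrow> 'b set) (N :: nat) (ys :: nat \<Rightarrow> 'b)
      (time :: nat \<Rightarrow> real) (n :: nat) (P :: nat \<Rightarrow> nat \<Rightarrow> nat \<Rightarrow> real) (\<mu> :: 'a measure).
      prob_density_on \<Omega> \<rho> \<and> clustering \<Omega> \<rho> Ny \<omega> \<and> physical_mesh D I cell xc \<and>
      N \<ge> 1 \<and> (\<forall>j\<in>{1..N}. ys j \<in> \<Omega>) \<and>
      (\<lambda>(x, y). p x (time n) y)
        \<in> borel_measurable (restrict_space lborel D \<Otimes>\<^sub>M param_measure \<Omega> \<rho>) \<and>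
      \<mu> \<in> physical_measures D I xc \<and>
      Linf_norm (\<mu> \<Otimes>\<^sub>M param_measure \<Omega> \<rho>) (\<lambda>(x, y). p x (time n) y) \<le> ereal A \<and>
      Linf_norm (\<mu> \<Otimes>\<^sub>M param_measure \<Omega> \<rho>) (\<lambda>(x, y). sfv_function I cell Ny \<omega> P n x y) \<le> ereal B \<and>
      Linf_norm (\<mu> \<Otimes>\<^sub>M param_measure \<Omega> \<rho>)
          (\<lambda>(x, y). p x (time n) y - sfv_function I cell Ny \<omega> P n x y)
        \<le> ereal (C1 * mesh_size I cell powr q + C2 * cluster_size Ny \<omega> powr r) \<and>
      (\<forall>k\<in>{1..Ny}. \<bar>weight \<rho> \<omega> k - mc_weight N ys \<omega> k\<bar> \<le> c * (cluster_sd \<Omega> \<rho> \<omega> k / sqrt (real N)))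
      \<longrightarrow>
      Linf_norm \<mu> (\<lambda>x. exact_mean \<Omega> \<rho> p x (time n) - sfv_mean Ny N \<omega> ys P n (cell_index I cell x))
        \<le> ereal (C1 * mesh_size I cell powr q + C2 * cluster_size Ny \<omega> powr r
             + C3 * (max_cluster_sd \<Omega> \<rho> Ny \<omega> * real Ny / sqrt (real N))) \<and>
      Linf_norm \<mu> (\<lambda>x. exact_variance \<Omega> \<rho> p x (time n) - sfv_variance Ny N \<omega> ys P n (cell_index I cell x))
        \<le> ereal (C1' * mesh_size I cell powr q + C2' * cluster_size Ny \<omega> powr r
             + C3' * (max_cluster_sd \<Omega> \<rho> Ny \<omega> * real Ny / sqrt (real N)))"
proof -
  define \<kappa> where "\<kappa> = 1 + \<bar>c\<bar> + \<bar>c\<bar>\<^sup>2"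
  define L where "L = 2 * A + B + B * \<kappa>"
  define C3' where "C3' = (B\<^sup>2 + B * (A + B * \<kappa>)) * \<bar>c\<bar>"
  show ?thesis
  proof (rule exI[of _ "B * \<bar>c\<bar>"], rule exI[of _ "L * C1"], rule exI[of _ "L * C2"],
      rule exI[of _ C3'], intro allI impI, elim conjE)
    fix D :: "'a set" and \<Omega> :: "'b set" and \<rho> :: "'b \<Rightarrow> real" and p :: "'a \<Rightarrow> real \<Rightarrow> 'b \<Rightarrow> real"
      and I :: "nat set" and cell :: "nat \<Rightarrow> 'a set" and xc :: "nat \<Rightarrow> 'a"
      and Ny :: nat and \<omega> :: "nat \<Rightarrow> 'b set" and N :: nat and ys :: "nat \<Rightarrow> 'b"
      and time :: "nat \<Rightarrow> real" and n :: nat and P :: "nat \<Rightarrow> nat \<Rightarrow> nat \<Rightarrow> real" and \<mu> :: "'a measure"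
    define \<epsilon> where "\<epsilon> = C1 * mesh_size I cell powr q + C2 * cluster_size Ny \<omega> powr r"
    define s where "s = max_cluster_sd \<Omega> \<rho> Ny \<omega> * real Ny / sqrt (real N)"
    assume \<rho>: "prob_density_on \<Omega> \<rho>" and \<omega>: "clustering \<Omega> \<rho> Ny \<omega>"
      and mesh: "physical_mesh D I cell xc" and N: "N \<ge> 1"
      and p: "(\<lambda>(x, y). p x (time n) y)
        \<in> borel_measurable (restrict_space lborel D \<Otimes>\<^sub>M param_measure \<Omega> \<rho>)"
      and \<mu>: "\<mu> \<in> physical_measures D I xc"
      and A: "Linf_norm (\<mu> \<Otimes>\<^sub>M param_measure \<Omega> \<rho>) (\<lambda>(x, y). p x (time n) y) \<le> ereal A"
      and B: "Linf_norm (\<mu> \<Otimes>\<^sub>M param_measure \<Omega> \<rho>)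
        (\<lambda>(x, y). sfv_function I cell Ny \<omega> P n x y) \<le> ereal B"
      and approx: "Linf_norm (\<mu> \<Otimes>\<^sub>M param_measure \<Omega> \<rho>)
          (\<lambda>(x, y). p x (time n) y - sfv_function I cell Ny \<omega> P n x y)
        \<le> ereal (C1 * mesh_size I cell powr q + C2 * cluster_size Ny \<omega> powr r)"
      and weights: "\<forall>k\<in>{1..Ny}. \<bar>weight \<rho> \<omega> k - mc_weight N ys \<omega> k\<bar>
        \<le> c * (cluster_sd \<Omega> \<rho> \<omega> k / sqrt (real N))"
    interpret Q: prob_space "param_measure \<Omega> \<rho>"
      using \<rho> by (simp add: prob_density_on_def)
    interpret X: sigma_finite_measure \<mu>
      by (rule physical_measure_properties[OF mesh \<mu>])
    interpret pair_sigma_finite \<mu> "param_measure \<Omega> \<rho>" ..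
    \<comment> \<open>Fubini turns the bounds on \<open>D \<times> \<Omega>\<close> into bounds on almost every section. If \<open>\<mu>\<close> is
      the zero measure they are void, but so is the claim.\<close>
    note bounds = AE_space[of \<mu>] Linf_norm_le_imp_AE[OF A, THEN AE_pair]
      Linf_norm_le_imp_AE[OF B, THEN AE_pair] Linf_norm_le_imp_AE[OF approx, THEN AE_pair]
    have errors: "AE x in \<mu>.
        \<bar>exact_mean \<Omega> \<rho> p x (time n) - sfv_mean Ny N \<omega> ys P n (cell_index I cell x)\<bar>
          \<le> \<epsilon> + B * \<bar>c\<bar> * s \<and>
        \<bar>exact_variance \<Omega> \<rho> p x (time n) - sfv_variance Ny N \<omega> ys P n (cell_index I cell x)\<bar>
          \<le> L * \<epsilon> + C3' * s"
      using bounds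
    proof eventually_elim
      case (elim x)
      have "x \<in> space (restrict_space lborel D)"
        using elim(1) physical_measure_properties(2)[OF mesh \<mu>] by (auto simp: space_restrict_space)
      then have meas: "p x (time n) \<in> borel_measurable (param_measure \<Omega> \<rho>)"
        using measurable_Pair2[OF p] by simp
      note at_x = sfv_errors_at_point[where p = p, OF \<rho> \<omega> N meas elim(2-4)[unfolded prod.case] bspec[OF weights]]
      show ?case
        using at_x by (simp add: \<epsilon>_def s_def L_def C3'_def \<kappa>_def)
    qed
    have "Linf_norm \<mu> (\<lambda>x. exact_mean \<Omega> \<rho> p x (time n) - sfv_mean Ny N \<omega> ys P n (cell_index I cell x))
        \<le> ereal (\<epsilon> + B * \<bar>c\<bar> * s)"
      by (intro Linf_norm_leI physical_measure_properties(3)[OF mesh \<mu>] borel_measurable_diff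
          exact_mean_measurable[where p = p, OF \<rho> p] sfv_mean_measurable[OF mesh]) (use errors in auto)
    moreover have "Linf_norm \<mu>
        (\<lambda>x. exact_variance \<Omega> \<rho> p x (time n) - sfv_variance Ny N \<omega> ys P n (cell_index I cell x))
        \<le> ereal (L * \<epsilon> + C3' * s)"
      by (intro Linf_norm_leI physical_measure_properties(3)[OF mesh \<mu>] borel_measurable_diff
          exact_variance_measurable[where p = p, OF \<rho> p] sfv_variance_measurable[OF mesh]) (use errors in auto)
    ultimately show
      "Linf_norm \<mu> (\<lambda>x. exact_mean \<Omega> \<rho> p x (time n) - sfv_mean Ny N \<omega> ys P n (cell_index I cell x))
        \<le> ereal (C1 * mesh_size I cell powr q + C2 * cluster_size Ny \<omega> powr r
             + B * \<bar>c\<bar> * (max_cluster_sd \<Omega> \<rho> Ny \<omega> * real Ny / sqrt (real N))) \<and>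
      Linf_norm \<mu> (\<lambda>x. exact_variance \<Omega> \<rho> p x (time n) - sfv_variance Ny N \<omega> ys P n (cell_index I cell x))
        \<le> ereal (L * C1 * mesh_size I cell powr q + L * C2 * cluster_size Ny \<omega> powr r
             + C3' * (max_cluster_sd \<Omega> \<rho> Ny \<omega> * real Ny / sqrt (real N)))"
      by (simp add: \<epsilon>_def s_def distrib_left mult.assoc)
  qed
qed

end
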